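(* Let $T=T(w_n,v_n,d_n)$ with $|w_n|=|v_n|=1$ for all $n\in\mathbb{Z}$. Suppose that there exist a bijective mapping $g:\mathbb{Z}\to\mathbb{Z}$ and $N\in\mathbb{Z}$ such that the sets of singular values of $A_n$, for $n>N$, are distinct from each other, and such that $|d_{n+1}v_n-d_nw_n|^2=|d_{g(n)+1}v_{g(n)}-d_{g(n)}w_{g(n)}|^2$ for all $n\in\mathbb{Z}$. If one of the following two conditions is true (for all $n\in\mathbb{Z}$): (1) $d_{n+1}c_n+d_nc_{n-1}-d_{n+1}\overline{w_n}v_nc_{n-1}\notin\mathbb{R}$, where $c_n=\overline{d_n}\,\overline{w_n}v_n$; (2) $(\overline{d_{n+1}}w_n\overline{v_n}-\overline{d_n})\,|d_nv_{n-1}-d_{n-1}w_{n-1}|^2\neq(\overline{d_{n-1}}\,\overline{w_{n-1}}v_{n-1}-\overline{d_n})\,|d_{n+1}v_n-d_nw_n|^2$; then $T$ is irreducible.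
   Context: Let $\{e_n\}_{n\in\mathbb{Z}}$ be the standard orthonormal basis of $l^2(\mathbb{Z})$ (complex scalars). For sequences $\{w_n\}_{n\in\mathbb{Z}},\{v_n\}_{n\in\mathbb{Z}}$ of non-zero complex numbers, let $T_0,T_1$ be the bounded bilateral weighted shifts on $l^2(\mathbb{Z})$ given by $T_0e_n=w_ne_{n+1}$ and $T_1e_n=v_ne_{n+1}$. Let $\{d_n\}_{n\in\mathbb{Z}}$ be a uniformly bounded sequence of complex numbers and $X$ the diagonal operator $Xe_n=d_ne_n$; it is assumed that $XT_1\neq T_0X$. Define $$T(w_n,v_n,d_n)=\begin{pmatrix}T_0&XT_1-T_0X\\0&T_1\end{pmatrix}$$ acting on $l^2(\mathbb{Z})\oplus l^2(\mathbb{Z})$. Let $H(n)=\operatorname{span}\{(e_n,0),(0,e_n)\}$, $T_n=T|_{H(n)}:H(n)\to H(n+1)$ and $A_n=T_n^*T_n:H(n)\to H(n)$. A bounded operator is irreducible if its only reducing subspaces (closed subspaces $\mathcal{M}$ such that $\mathcal{M}$ and $\mathcal{M}^\perp$ are both invariant) are $\{0\}$ and the whole space. *)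

theory Defs
  imports "HOL-Analysis.Analysis"
begin

section \<open>Complex inner product spaces\<close>

text \<open>
  The norm and the topology are those of the underlying real inner product space; the inner
  product \<open>cinner\<close> is linear in its first argument.
\<close>

class complex_inner = real_inner +
  fixes scaleC :: "complex \<Rightarrow> 'a \<Rightarrow> 'a" (infixr "*\<^sub>C" 75)
    and cinner :: "'a \<Rightarrow> 'a \<Rightarrow> complex"
  assumes scaleC_add_right: "a *\<^sub>C (x + y) = a *\<^sub>C x + a *\<^sub>C y"
    and scaleC_add_left: "(a + b) *\<^sub>C x = a *\<^sub>C x + b *\<^sub>C x"
    and scaleC_scaleC: "a *\<^sub>C b *\<^sub>C x = (a * b) *\<^sub>C x"
    and scaleC_of_real: "complex_of_real r *\<^sub>C x = r *\<^sub>R x"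
    and cinner_commute: "cinner x y = cnj (cinner y x)"
    and cinner_add_left: "cinner (x + y) z = cinner x z + cinner y z"
    and cinner_scaleC_left: "cinner (a *\<^sub>C x) y = a * cinner x y"
    and Re_cinner: "Re (cinner x y) = inner x y"

global_interpretation complex_vector:
  vector_space "scaleC :: complex \<Rightarrow> 'a \<Rightarrow> 'a :: complex_inner"
  defines csubspace = complex_vector.subspace
    and cspan = complex_vector.span
proof
  show "1 *\<^sub>C x = x" for x :: 'a
    using scaleC_of_real[of 1 x] by simp
qed (simp_all add: scaleC_add_right scaleC_add_left scaleC_scaleC)

text \<open>Direct sums carry the Hilbert sum structure; the real part of it is already in the library.\<close>

instantiation prod :: (complex_inner, complex_inner) complex_inner
begin

definition scaleC_prod_def: "a *\<^sub>C x = (a *\<^sub>C fst x, a *\<^sub>C snd x)"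

definition cinner_prod_def: "cinner x y = cinner (fst x) (fst y) + cinner (snd x) (snd y)"

instance
proof
  fix x y :: "'a \<times> 'b"
  show "cinner x y = cnj (cinner y x)"
    unfolding cinner_prod_def complex_cnj_add by (intro arg_cong2[where f = "(+)"] cinner_commute)
qed (simp_all add: scaleC_prod_def cinner_prod_def scaleC_add_right scaleC_add_left scaleC_scaleC
      scaleC_of_real cinner_add_left cinner_scaleC_left Re_cinner inner_prod_def scaleR_prod_def
      algebra_simps)

end

definition orth_complement :: "'a::complex_inner set \<Rightarrow> 'a set" where
  "orth_complement M = {y. \<forall>x\<in>M. cinner x y = 0}"

definition reducing_subspace :: "('a::complex_inner \<Rightarrow> 'a) \<Rightarrow> 'a set \<Rightarrow> bool" where
  "reducing_subspace T M \<longleftrightarrow>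
     csubspace M \<and> closed M \<and> T ` M \<subseteq> M \<and> T ` orth_complement M \<subseteq> orth_complement M"

definition irreducible_operator :: "('a::complex_inner \<Rightarrow> 'a) \<Rightarrow> bool" where
  "irreducible_operator T \<longleftrightarrow> (\<forall>M. reducing_subspace T M \<longrightarrow> M = {0} \<or> M = UNIV)"

text \<open>
  The adjoint of the restriction of \<open>T\<close> to a finite-dimensional subspace \<open>V\<close>, regarded as a map
  from \<open>V\<close> into any subspace \<open>W\<close> containing \<open>T ` V\<close>: at \<open>y \<in> W\<close> it is the Riesz representative
  in \<open>V\<close> of \<open>u \<mapsto> \<langle>T u, y\<rangle>\<close>, which does not depend on \<open>W\<close>.
\<close>

definition adjoint_on :: "'a::complex_inner set \<Rightarrow> ('a \<Rightarrow> 'b::complex_inner) \<Rightarrow> 'b \<Rightarrow> 'a" where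
  "adjoint_on V T y = (THE x. x \<in> V \<and> (\<forall>u\<in>V. cinner (T u) y = cinner u x))"

text \<open>
  Singular values of an operator \<open>A\<close> on \<open>V\<close>: the nonnegative square roots of the eigenvalues
  of \<open>A\<^sup>*A\<close>.
\<close>

definition singular_values_on :: "'a::complex_inner set \<Rightarrow> ('a \<Rightarrow> 'a) \<Rightarrow> real set" where
  "singular_values_on V A =
     {s. 0 \<le> s \<and> (\<exists>x\<in>V. x \<noteq> 0 \<and> adjoint_on V A (A x) = complex_of_real (s\<^sup>2) *\<^sub>C x)}"


section \<open>Square-summable sequences\<close>

typedef 'a ell2 = "{f :: 'a \<Rightarrow> complex. (\<lambda>i. (cmod (f i))\<^sup>2) summable_on UNIV}"
  morphisms coord Abs_ell2
  by (rule exI[of _ "\<lambda>_. 0"]) simp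

setup_lifting type_definition_ell2

lemma ell2_add:
  assumes "(\<lambda>i. (cmod (f i))\<^sup>2) summable_on UNIV" "(\<lambda>i. (cmod (g i))\<^sup>2) summable_on UNIV"
  shows "(\<lambda>i. (cmod (f i + g i))\<^sup>2) summable_on UNIV"
proof (rule summable_on_comparison_test)
  show "(\<lambda>i. 2 * (cmod (f i))\<^sup>2 + 2 * (cmod (g i))\<^sup>2) summable_on UNIV"
    by (intro summable_on_add summable_on_cmult_right assms)
  fix i
  have "(cmod (f i + g i))\<^sup>2 \<le> (cmod (f i) + cmod (g i))\<^sup>2"
    by (intro power_mono norm_triangle_ineq) simp
  also have "\<dots> \<le> 2 * (cmod (f i))\<^sup>2 + 2 * (cmod (g i))\<^sup>2"
    using sum_squares_bound[of "cmod (f i)" "cmod (g i)"] by (simp add: power2_sum)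
  finally show "(cmod (f i + g i))\<^sup>2 \<le> 2 * (cmod (f i))\<^sup>2 + 2 * (cmod (g i))\<^sup>2" .
qed simp

lemma ell2_mult_bounded:
  assumes "(\<lambda>i. (cmod (f i))\<^sup>2) summable_on UNIV" "\<And>i. cmod (a i) \<le> B"
  shows "(\<lambda>i. (cmod (a i * f i))\<^sup>2) summable_on UNIV"
proof (rule summable_on_comparison_test)
  show "(\<lambda>i. B\<^sup>2 * (cmod (f i))\<^sup>2) summable_on UNIV"
    by (intro summable_on_cmult_right assms)
  show "(cmod (a i * f i))\<^sup>2 \<le> B\<^sup>2 * (cmod (f i))\<^sup>2" for i
    using assms(2)[of i] by (auto simp: norm_mult power_mult_distrib intro!: mult_right_mono power_mono)
qed simp

lemma ell2_product_summable:
  assumes "(\<lambda>i. (cmod (f i))\<^sup>2) summable_on UNIV" "(\<lambda>i. (cmod (g i))\<^sup>2) summable_on UNIV"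
  shows "(\<lambda>i. f i * cnj (g i)) summable_on UNIV"
proof (rule abs_summable_summable, rule summable_on_comparison_test)
  show "(\<lambda>i. (cmod (f i))\<^sup>2 + (cmod (g i))\<^sup>2) summable_on UNIV"
    by (intro summable_on_add assms)
  fix i
  have "0 \<le> cmod (f i) * cmod (g i)" by simp
  then show "norm (f i * cnj (g i)) \<le> (cmod (f i))\<^sup>2 + (cmod (g i))\<^sup>2"
    using sum_squares_bound[of "cmod (f i)" "cmod (g i)"] unfolding norm_mult complex_mod_cnj by linarith
qed simp

instantiation ell2 :: (type) real_vector
begin

lift_definition zero_ell2 :: "'a ell2" is "\<lambda>_. 0" by simp

lift_definition plus_ell2 :: "'a ell2 \<Rightarrow> 'a ell2 \<Rightarrow> 'a ell2" is "\<lambda>f g i. f i + g i"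
  by (rule ell2_add)

lift_definition uminus_ell2 :: "'a ell2 \<Rightarrow> 'a ell2" is "\<lambda>f i. - f i" by simp

lift_definition minus_ell2 :: "'a ell2 \<Rightarrow> 'a ell2 \<Rightarrow> 'a ell2" is "\<lambda>f g i. f i - g i"
  using ell2_add[of _ "\<lambda>i. - g i" for g] by simp

lift_definition scaleR_ell2 :: "real \<Rightarrow> 'a ell2 \<Rightarrow> 'a ell2" is
  "\<lambda>r f i. complex_of_real r * f i"
  by (rule ell2_mult_bounded) auto

instance
  by (standard; transfer) (simp_all add: algebra_simps fun_eq_iff)

end

instantiation ell2 :: (type) complex_inner
begin

lift_definition scaleC_ell2 :: "complex \<Rightarrow> 'a ell2 \<Rightarrow> 'a ell2" is "\<lambda>a f i. a * f i"
  by (rule ell2_mult_bounded) auto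

lift_definition cinner_ell2 :: "'a ell2 \<Rightarrow> 'a ell2 \<Rightarrow> complex" is
  "\<lambda>f g. \<Sum>\<^sub>\<infinity>i. f i * cnj (g i)" .

definition inner_ell2_def: "inner x y = Re (cinner x y)" for x y :: "'a ell2"

definition norm_ell2_def: "norm x = sqrt (inner x x)" for x :: "'a ell2"

definition sgn_ell2_def: "sgn x = x /\<^sub>R norm x" for x :: "'a ell2"

definition dist_ell2_def: "dist x y = norm (x - y)" for x y :: "'a ell2"

definition uniformity_ell2_def:
  "(uniformity :: ('a ell2 \<times> 'a ell2) filter) =
     (INF e\<in>{0<..}. principal {(x, y). dist x y < e})"

definition open_ell2_def:
  "open U \<longleftrightarrow> (\<forall>x\<in>U. eventually (\<lambda>(x', y). x' = x \<longrightarrow> y \<in> U) uniformity)"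
  for U :: "'a ell2 set"

instance
proof
  fix x y z :: "'a ell2" and a b :: complex and r s :: real
  have add: "cinner (u + v) t = cinner u t + cinner v t" for u v t :: "'a ell2"
    by transfer (simp add: distrib_right infsum_add ell2_product_summable)
  have scale: "cinner (c *\<^sub>C u) t = c * cinner u t" for c and u t :: "'a ell2"
    by transfer (simp add: mult.assoc infsum_cmult_right')
  have comm: "cinner u t = cnj (cinner t u)" for u t :: "'a ell2"
    by transfer (simp add: mult.commute flip: infsum_cnj)
  show "a *\<^sub>C (x + y) = a *\<^sub>C x + a *\<^sub>C y" "(a + b) *\<^sub>C x = a *\<^sub>C x + b *\<^sub>C x"
    "a *\<^sub>C b *\<^sub>C x = (a * b) *\<^sub>C x"
    by (transfer, simp add: algebra_simps)+
  show scaleC_real: "complex_of_real r *\<^sub>C x = r *\<^sub>R x" for r and x :: "'a ell2"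
    by transfer simp
  show "dist x y = norm (x - y)" by (rule dist_ell2_def)
  show "sgn x = x /\<^sub>R norm x" by (rule sgn_ell2_def)
  show "norm x = sqrt (inner x x)" by (rule norm_ell2_def)
  show "(uniformity :: ('a ell2 \<times> 'a ell2) filter)
      = (INF e\<in>{0<..}. principal {(x, y). dist x y < e})"
    by (rule uniformity_ell2_def)
  show "open U \<longleftrightarrow> (\<forall>x\<in>U. eventually (\<lambda>(x', y). x' = x \<longrightarrow> y \<in> U) uniformity)"
    for U :: "'a ell2 set"
    by (rule open_ell2_def)
  show "inner x y = inner y x"
    unfolding inner_ell2_def by (subst comm) simp
  show "inner (x + y) z = inner x z + inner y z" "inner (r *\<^sub>R x) y = r * inner x y"
    by (simp_all add: inner_ell2_def add scale flip: scaleC_real)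
  have xx: "inner u u = (\<Sum>\<^sub>\<infinity>i. (cmod (coord u i))\<^sup>2)" for u :: "'a ell2"
  proof -
    have "(\<lambda>i. coord u i * cnj (coord u i)) summable_on UNIV"
      using coord[of u] by (intro ell2_product_summable) auto
    then show ?thesis
      by (simp add: inner_ell2_def cinner_ell2.rep_eq cmod_power2 flip: infsum_Re power2_eq_square)
  qed
  show "0 \<le> inner x x" unfolding xx by (rule infsum_nonneg) simp
  show "inner x x = 0 \<longleftrightarrow> x = 0"
  proof
    assume "inner x x = 0"
    moreover have "(\<lambda>i. (cmod (coord x i))\<^sup>2) summable_on UNIV" using coord[of x] by simp
    ultimately have "(cmod (coord x i))\<^sup>2 = 0" for i
      unfolding xx by (intro nonneg_infsum_le_0D[where A = UNIV]) auto
    then show "x = 0" by (simp add: zero_ell2.rep_eq fun_eq_iff flip: coord_inject)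
  qed (simp add: xx zero_ell2.rep_eq)
  show "cinner x y = cnj (cinner y x)" by (rule comm)
  show "cinner (x + y) z = cinner x z + cinner y z" "cinner (a *\<^sub>C x) y = a * cinner x y"
    by (rule add, rule scale)
  show "Re (cinner x y) = inner x y" by (simp add: inner_ell2_def)
qed

end

lift_definition ebasis :: "'a \<Rightarrow> 'a ell2" is "\<lambda>n i. if i = n then 1 else 0"
  by (rule finite_nonzero_values_imp_summable_on) (auto intro: finite_subset[of _ "{n}" for n])


section \<open>The operators\<close>

text \<open>
  The coordinate formulas describe elements of \<open>\<ell>\<^sup>2\<close> as soon as the weights are bounded.
\<close>

definition bshift :: "(int \<Rightarrow> complex) \<Rightarrow> int ell2 \<Rightarrow> int ell2" where
  "bshift w x = Abs_ell2 (\<lambda>n. w (n - 1) * coord x (n - 1))"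

definition diag_op :: "(int \<Rightarrow> complex) \<Rightarrow> int ell2 \<Rightarrow> int ell2" where
  "diag_op d x = Abs_ell2 (\<lambda>n. d n * coord x n)"

lemma coord_bshift:
  assumes "bounded (range w)"
  shows "coord (bshift w x) n = w (n - 1) * coord x (n - 1)"
proof -
  obtain B where "\<And>i. cmod (w i) \<le> B" using assms by (auto simp: bounded_iff)
  moreover have "(\<lambda>i. (cmod (coord x i))\<^sup>2) summable_on UNIV" using coord[of x] by simp
  ultimately have "(\<lambda>i. (cmod (w i * coord x i))\<^sup>2) summable_on UNIV"
    by (intro ell2_mult_bounded)
  moreover have "bij_betw (\<lambda>n. n - 1) UNIV (UNIV :: int set)"
    by (rule bij_betwI[where g = "\<lambda>n. n + 1"]) auto
  ultimately have "(\<lambda>i. (cmod (w (i - 1) * coord x (i - 1)))\<^sup>2) summable_on UNIV"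
    using summable_on_reindex_bij_betw[of "\<lambda>n. n - 1" UNIV UNIV "\<lambda>i. (cmod (w i * coord x i))\<^sup>2"]
    by simp
  then show ?thesis unfolding bshift_def by (subst Abs_ell2_inverse) auto
qed

lemma coord_diag_op:
  assumes "bounded (range d)"
  shows "coord (diag_op d x) n = d n * coord x n"
proof -
  obtain B where "\<And>i. cmod (d i) \<le> B" using assms by (auto simp: bounded_iff)
  moreover have "(\<lambda>i. (cmod (coord x i))\<^sup>2) summable_on UNIV" using coord[of x] by simp
  ultimately have "(\<lambda>i. (cmod (d i * coord x i))\<^sup>2) summable_on UNIV"
    by (intro ell2_mult_bounded)
  then show ?thesis unfolding diag_op_def by (subst Abs_ell2_inverse) auto
qed

lemma bshift_ebasis: "bounded (range w) \<Longrightarrow> bshift w (ebasis n) = w n *\<^sub>C ebasis (n + 1)"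
  by (auto simp: coord_bshift scaleC_ell2.rep_eq ebasis.rep_eq fun_eq_iff simp flip: coord_inject)

lemma diag_op_ebasis: "bounded (range d) \<Longrightarrow> diag_op d (ebasis n) = d n *\<^sub>C ebasis n"
  by (auto simp: coord_diag_op scaleC_ell2.rep_eq ebasis.rep_eq fun_eq_iff simp flip: coord_inject)

definition T_op ::
  "(int \<Rightarrow> complex) \<Rightarrow> (int \<Rightarrow> complex) \<Rightarrow> (int \<Rightarrow> complex) \<Rightarrow>
    int ell2 \<times> int ell2 \<Rightarrow> int ell2 \<times> int ell2"
  where
    "T_op w v d = (\<lambda>(x, y).
       (bshift w x + (diag_op d (bshift v y) - bshift w (diag_op d y)), bshift v y))"

definition H_sp :: "int \<Rightarrow> (int ell2 \<times> int ell2) set" where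
  "H_sp n = cspan {(ebasis n, 0), (0, ebasis n)}"

text \<open>\<open>A\<^sub>n = T\<^sub>n\<^sup>*T\<^sub>n\<close> with \<open>T\<^sub>n\<close> the restriction of \<open>T\<close> to \<open>H(n)\<close>; it is only used on \<open>H(n)\<close>.\<close>

definition A_op ::
  "(int \<Rightarrow> complex) \<Rightarrow> (int \<Rightarrow> complex) \<Rightarrow> (int \<Rightarrow> complex) \<Rightarrow> int \<Rightarrow>
    int ell2 \<times> int ell2 \<Rightarrow> int ell2 \<times> int ell2"
  where "A_op w v d n x = adjoint_on (H_sp n) (T_op w v d) (T_op w v d x)"

definition c_seq ::
  "(int \<Rightarrow> complex) \<Rightarrow> (int \<Rightarrow> complex) \<Rightarrow> (int \<Rightarrow> complex) \<Rightarrow> int \<Rightarrow> complex"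
  where "c_seq w v d n = cnj (d n) * cnj (w n) * v n"

end

theory Submission
  imports Defs
begin

text \<open>
  Write \<open>T\<^sub>n\<close> as a two-by-two matrix with respect to the standard bases of \<open>H(n)\<close> and \<open>H(n + 1)\<close>: it
  is upper triangular with unimodular diagonal \<open>w\<^sub>n, v\<^sub>n\<close> and corner
  \<open>a\<^sub>n = d\<^sub>n\<^sub>+\<^sub>1v\<^sub>n - d\<^sub>nw\<^sub>n\<close>.  Let \<open>P\<close> be the orthogonal projection onto a reducing subspace, with
  blocks \<open>P\<^sub>i\<^sub>j : H(j) \<rightarrow> H(i)\<close>.  Since \<open>P\<close> commutes with \<open>T\<close> and is self-adjoint, the blocks satisfy
  \<open>P\<^sub>i\<^sub>+\<^sub>1\<^sub>,\<^sub>j\<^sub>+\<^sub>1T\<^sub>j = T\<^sub>iP\<^sub>i\<^sub>j\<close> and the adjoint relation, hence \<open>A\<^sub>iP\<^sub>i\<^sub>j = P\<^sub>i\<^sub>jA\<^sub>j\<close>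
  (\<open>proj_block_intertwines\<close>).

  Every \<open>A\<^sub>n\<close> has determinant 1 and trace \<open>2 + |a\<^sub>n|\<^sup>2\<close>, and its singular values depend only on
  \<open>|a\<^sub>n|\<close> (\<open>singular_values_gram_matrix_cong\<close>).  For \<open>i \<noteq> j\<close> beyond \<open>N\<close> the traces of
  \<open>A\<^sub>i\<close> and \<open>A\<^sub>j\<close> therefore differ and \<open>P\<^sub>i\<^sub>j = 0\<close> (\<open>intertwiner_eq_0\<close>).  As the \<open>T\<^sub>n\<close> are
  invertible, the shift relation propagates this to all \<open>i \<noteq> j\<close>: the projection is block diagonal.

  The diagonal block \<open>P\<^sub>n\<^sub>n\<close> commutes with both \<open>T\<^sub>n\<^sup>*T\<^sub>n\<close> and \<open>T\<^sub>n\<^sub>-\<^sub>1T\<^sub>n\<^sub>-\<^sub>1\<^sup>*\<close>.  Each of the conditions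
  (1) and (2) prevents these two matrices from commuting with each other
  (\<open>T_matrix_commuting_imp\<close>), and a two-by-two matrix that commutes with a noncommuting pair is
  scalar (\<open>commutes_with_noncommuting_pair_imp_scalar\<close>).  The shift relation makes the scalar the
  same for all \<open>n\<close>, so \<open>P\<close> is a scalar multiple of the identity and the subspace is trivial.

  The argument needs the orthogonal projection onto a closed subspace, hence completeness of the
  space of square-summable sequences.
\<close>

section \<open>Complex inner products\<close>

lemma cinner_add_right: "cinner x (y + z) = cinner x y + cinner x z"
  for x y z :: "'a::complex_inner"
  by (metis cinner_add_left cinner_commute complex_cnj_add)

lemma cinner_scaleC_right: "cinner x (a *\<^sub>C y) = cnj a * cinner x y"
  for x y :: "'a::complex_inner"
  by (metis cinner_commute cinner_scaleC_left complex_cnj_mult)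

lemma cinner_zero_left [simp]: "cinner 0 x = 0" for x :: "'a::complex_inner"
  using cinner_add_left[of 0 0 x] by simp

lemma cinner_zero_right [simp]: "cinner x 0 = 0" for x :: "'a::complex_inner"
  using cinner_add_right[of x 0 0] by simp

lemma cinner_minus_left: "cinner (- x) y = - cinner x y" for x y :: "'a::complex_inner"
  using cinner_add_left[of x "- x" y] by (simp add: eq_neg_iff_add_eq_0 add.commute)

lemma cinner_diff_left: "cinner (x - y) z = cinner x z - cinner y z" for x y z :: "'a::complex_inner"
  using cinner_add_left[of x "- y" z] by (simp add: cinner_minus_left)

lemma cinner_eq_zero_iff [simp]: "cinner x x = 0 \<longleftrightarrow> x = 0" for x :: "'a::complex_inner"
  by (metis Re_cinner cinner_zero_left inner_eq_zero_iff zero_complex.sel(1))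

text \<open>Multiplying \<open>y\<close> by \<open>\<i>\<close> turns the imaginary part of the inner product into a real part.\<close>

lemma cinner_eq_zeroI:
  fixes x y :: "'a::complex_inner"
  assumes "\<And>a. Re (cinner x (a *\<^sub>C y)) = 0"
  shows "cinner x y = 0"
  using assms[of 1] assms[of \<i>] by (simp add: cinner_scaleC_right complex_eq_iff)


section \<open>Completeness of the space of square-summable sequences\<close>

lemma norm_ell2_sq: "(norm x)\<^sup>2 = (\<Sum>\<^sub>\<infinity>i. (cmod (coord x i))\<^sup>2)"
proof -
  have "(\<lambda>i. coord x i * cnj (coord x i)) summable_on UNIV"
    using coord[of x] by (intro ell2_product_summable) auto
  then show ?thesis
    by (simp add: power2_norm_eq_inner inner_ell2_def cinner_ell2.rep_eq inner_complex_def
        flip: infsum_Re)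
qed

lemma sum_coord_le_norm:
  assumes "finite F"
  shows "(\<Sum>i\<in>F. (cmod (coord x i))\<^sup>2) \<le> (norm x)\<^sup>2"
  unfolding norm_ell2_sq using assms coord[of x] by (intro finite_sum_le_infsum) auto

lemma cmod_coord_le_norm: "cmod (coord x i) \<le> norm x"
  using sum_coord_le_norm[of "{i}" x] by (simp add: power2_le_iff_abs_le)

lemma coord_diff: "coord (x - y) i = coord x i - coord y i"
  by (simp add: minus_ell2.rep_eq)

lemma ell2_boundedI:
  assumes "\<And>F. finite F \<Longrightarrow> (\<Sum>i\<in>F. (cmod (f i))\<^sup>2) \<le> B\<^sup>2" "0 \<le> B"
  obtains x where "coord x = f" "norm x \<le> B"
proof -
  have f: "(\<lambda>i. (cmod (f i))\<^sup>2) summable_on UNIV"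
    using assms by (intro nonneg_bdd_above_summable_on) (auto simp: bdd_above_def)
  then have c: "coord (Abs_ell2 f) = f" by (simp add: Abs_ell2_inverse)
  have "(norm (Abs_ell2 f))\<^sup>2 \<le> B\<^sup>2"
    unfolding norm_ell2_sq c using f assms by (intro infsum_le_finite_sums) auto
  then have "norm (Abs_ell2 f) \<le> B" using assms(2) by (simp add: power2_le_iff_abs_le)
  with c show ?thesis by (rule that)
qed

text \<open>
  The coordinatewise limit of a Cauchy sequence satisfies
  the Cauchy estimate on every finite set of coordinates, hence on all of them.
\<close>

instance ell2 :: (type) complete_space
proof
  fix X :: "nat \<Rightarrow> 'a ell2"
  assume X: "Cauchy X"
  have "Cauchy (\<lambda>n. coord (X n) i)" for i
  proof (rule metric_CauchyI)
    fix e :: real assume "e > 0"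
    then obtain M where M: "\<And>m n. m \<ge> M \<Longrightarrow> n \<ge> M \<Longrightarrow> dist (X m) (X n) < e"
      using metric_CauchyD[OF X] by blast
    have "dist (coord (X m) i) (coord (X n) i) \<le> dist (X m) (X n)" for m n
      using cmod_coord_le_norm[of "X m - X n" i] by (simp add: dist_norm coord_diff)
    then show "\<exists>M. \<forall>m\<ge>M. \<forall>n\<ge>M. dist (coord (X m) i) (coord (X n) i) < e"
      using M by (meson le_less_trans)
  qed
  then have "\<forall>i. \<exists>l. (\<lambda>n. coord (X n) i) \<longlonglongrightarrow> l"
    using Cauchy_convergent convergent_def by blast
  then obtain f where f: "\<And>i. (\<lambda>n. coord (X n) i) \<longlonglongrightarrow> f i" by metis
  have tail: "\<exists>M. \<forall>m\<ge>M. \<exists>y. coord y = (\<lambda>i. coord (X m) i - f i) \<and> norm y \<le> e" if "e > 0" for e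
  proof -
    obtain M where M: "\<And>m n. m \<ge> M \<Longrightarrow> n \<ge> M \<Longrightarrow> dist (X m) (X n) < e"
      using metric_CauchyD[OF X \<open>e > 0\<close>] by blast
    have "\<exists>y. coord y = (\<lambda>i. coord (X m) i - f i) \<and> norm y \<le> e" if "m \<ge> M" for m
    proof (rule ell2_boundedI)
      fix F :: "'a set" assume "finite F"
      show "(\<Sum>i\<in>F. (cmod (coord (X m) i - f i))\<^sup>2) \<le> e\<^sup>2"
      proof (rule tendsto_upperbound)
        show "(\<lambda>n. \<Sum>i\<in>F. (cmod (coord (X m) i - coord (X n) i))\<^sup>2)
            \<longlonglongrightarrow> (\<Sum>i\<in>F. (cmod (coord (X m) i - f i))\<^sup>2)"
          by (intro tendsto_intros f)
        have "(\<Sum>i\<in>F. (cmod (coord (X m) i - coord (X n) i))\<^sup>2) \<le> e\<^sup>2" if "n \<ge> M" for n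
        proof -
          have "(norm (X m - X n))\<^sup>2 \<le> e\<^sup>2"
            using M[OF \<open>m \<ge> M\<close> that] by (intro power_mono) (auto simp: dist_norm)
          then show ?thesis
            using sum_coord_le_norm[OF \<open>finite F\<close>, of "X m - X n"] by (simp add: coord_diff)
        qed
        then show "\<forall>\<^sub>F n in sequentially. (\<Sum>i\<in>F. (cmod (coord (X m) i - coord (X n) i))\<^sup>2) \<le> e\<^sup>2"
          by (rule eventually_sequentiallyI)
      qed simp
    qed (use \<open>e > 0\<close> in auto)
    then show ?thesis by blast
  qed
  obtain m y where y: "coord y = (\<lambda>i. coord (X m) i - f i)"
    using tail[of 1] by fastforce
  define x where "x = X m - y"
  have x: "coord x = f" by (auto simp: x_def coord_diff y)
  have "X \<longlonglongrightarrow> x"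
  proof (rule metric_LIMSEQ_I)
    fix e :: real assume "e > 0"
    then obtain M where M: "\<And>m. m \<ge> M \<Longrightarrow> \<exists>y. coord y = (\<lambda>i. coord (X m) i - f i) \<and> norm y \<le> e/2"
      using tail[of "e/2"] by auto
    have "dist (X m) x < e" if m: "m \<ge> M" for m
    proof -
      obtain y where y: "coord y = (\<lambda>i. coord (X m) i - f i)" "norm y \<le> e/2"
        using M[OF m] by blast
      have "y = X m - x" by (auto simp: coord_diff y x simp flip: coord_inject)
      then show ?thesis using y(2) \<open>e > 0\<close> by (simp add: dist_norm)
    qed
    then show "\<exists>no. \<forall>n\<ge>no. dist (X n) x < e" by blast
  qed
  then show "convergent X" by (auto simp: convergent_def)
qed


section \<open>Orthogonal projections\<close>

lemma csubspace_scaleR: "csubspace M \<Longrightarrow> x \<in> M \<Longrightarrow> r *\<^sub>R x \<in> M"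
  for x :: "'a::complex_inner"
  by (metis complex_vector.subspace_scale scaleC_of_real)

text \<open>
  By the parallelogram law two points of \<open>M\<close> that are almost nearest to \<open>x\<close> are close to each
  other, because their midpoint is no nearer than the infimum; so a minimizing sequence is Cauchy.
\<close>

lemma nearest_point_exists:
  fixes x :: "'a::{complex_inner, complete_space}"
  assumes M: "csubspace M" "closed M"
  obtains p where "p \<in> M" "\<And>y. y \<in> M \<Longrightarrow> norm (x - p) \<le> norm (x - y)"
proof -
  define \<delta> where "\<delta> = (INF y\<in>M. (norm (x - y))\<^sup>2)"
  have M0: "M \<noteq> {}" using complex_vector.subspace_0[OF M(1)] by blast
  have bdd: "bdd_below ((\<lambda>y. (norm (x - y))\<^sup>2) ` M)" by (rule bdd_belowI2[of _ 0]) simp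
  have \<delta>: "\<delta> \<le> (norm (x - y))\<^sup>2" if "y \<in> M" for y
    unfolding \<delta>_def using bdd that by (rule cINF_lower)
  have "\<exists>y\<in>M. (norm (x - y))\<^sup>2 < \<delta> + 1 / real (Suc n)" for n
    using cINF_less_iff[OF M0 bdd, of "\<delta> + 1 / real (Suc n)"] by (simp add: \<delta>_def)
  then obtain m where m: "\<And>n. m n \<in> M" "\<And>n. (norm (x - m n))\<^sup>2 < \<delta> + 1 / real (Suc n)"
    by metis
  have mid: "(norm (m k - m l))\<^sup>2 \<le> 2 / real (Suc k) + 2 / real (Suc l)" for k l
  proof -
    have "(1/2) *\<^sub>R (m k + m l) \<in> M"
      using m(1) M(1) by (intro csubspace_scaleR complex_vector.subspace_add)
    from \<delta>[OF this] have "4 * \<delta> \<le> (norm (2 *\<^sub>R (x - (1/2) *\<^sub>R (m k + m l))))\<^sup>2"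
      by (simp add: power_mult_distrib)
    also have "2 *\<^sub>R (x - (1/2) *\<^sub>R (m k + m l)) = (x - m k) + (x - m l)"
      by (simp add: algebra_simps scaleR_2)
    finally have "4 * \<delta> \<le> (norm ((x - m k) + (x - m l)))\<^sup>2" .
    moreover have "(norm ((x - m k) + (x - m l)))\<^sup>2 + (norm (m k - m l))\<^sup>2
        = 2 * (norm (x - m k))\<^sup>2 + 2 * (norm (x - m l))\<^sup>2"
      by (simp add: power2_norm_eq_inner algebra_simps inner_commute)
    ultimately show ?thesis using m(2)[of k] m(2)[of l] by linarith
  qed
  have "Cauchy m"
  proof (rule metric_CauchyI)
    fix e :: real assume "e > 0"
    then obtain K where K: "4 / real (Suc K) < e\<^sup>2"
      using reals_Archimedean[of "e\<^sup>2 / 4"] by (auto simp: inverse_eq_divide field_simps)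
    have "dist (m k) (m l) < e" if "k \<ge> K" "l \<ge> K" for k l
    proof -
      have "2 / real (Suc k) \<le> 2 / real (Suc K)" "2 / real (Suc l) \<le> 2 / real (Suc K)"
        using that by (auto intro!: divide_left_mono)
      then have "(norm (m k - m l))\<^sup>2 < e\<^sup>2" using mid[of k l] K by simp
      then show ?thesis using \<open>e > 0\<close> by (simp add: dist_norm power2_less_imp_less)
    qed
    then show "\<exists>M. \<forall>k\<ge>M. \<forall>l\<ge>M. dist (m k) (m l) < e" by blast
  qed
  then obtain p where p: "m \<longlonglongrightarrow> p" using Cauchy_convergent convergent_def by blast
  have "p \<in> M" using M(2) m(1) p by (rule closed_sequentially)
  have "(norm (x - p))\<^sup>2 \<le> \<delta>"
  proof (rule LIMSEQ_le)
    show "(\<lambda>n. (norm (x - m n))\<^sup>2) \<longlonglongrightarrow> (norm (x - p))\<^sup>2" by (intro tendsto_intros p)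
    show "(\<lambda>n. \<delta> + 1 / real (Suc n)) \<longlonglongrightarrow> \<delta>"
      using LIMSEQ_inverse_real_of_nat_add[of \<delta>] by (simp add: inverse_eq_divide)
    show "\<exists>N. \<forall>n\<ge>N. (norm (x - m n))\<^sup>2 \<le> \<delta> + 1 / real (Suc n)" using m(2) less_imp_le by blast
  qed
  then have "norm (x - p) \<le> norm (x - y)" if "y \<in> M" for y
    using \<delta>[OF that] by (meson norm_ge_zero order_trans power2_le_imp_le)
  with \<open>p \<in> M\<close> show ?thesis by (rule that)
qed

text \<open>
  If the residual at the nearest point had a component along some \<open>y\<close>, moving by that component
  would bring the point nearer.
\<close>

lemma orthogonal_decomposition:
  fixes x :: "'a::{complex_inner, complete_space}"
  assumes M: "csubspace M" "closed M"
  shows "\<exists>p\<in>M. x - p \<in> orth_complement M"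
proof -
  obtain p where p: "p \<in> M" "\<And>y. y \<in> M \<Longrightarrow> norm (x - p) \<le> norm (x - y)"
    using nearest_point_exists[OF M, of x] by blast
  have real: "inner (x - p) y = 0" if "y \<in> M" for y
  proof (cases "y = 0")
    case False
    define t where "t = inner (x - p) y / (norm y)\<^sup>2"
    have "(norm (x - p))\<^sup>2 \<le> (norm (x - (p + t *\<^sub>R y)))\<^sup>2"
      using p(1) that M(1) by (intro power_mono p(2) complex_vector.subspace_add csubspace_scaleR) auto
    also have "\<dots> = (norm (x - p))\<^sup>2 - 2 * t * inner (x - p) y + t\<^sup>2 * (norm y)\<^sup>2"
      unfolding power2_norm_eq_inner
      by (simp add: algebra_simps inner_commute power2_eq_square)
    also have "\<dots> = (norm (x - p))\<^sup>2 - (inner (x - p) y)\<^sup>2 / (norm y)\<^sup>2"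
      using False by (simp add: t_def field_simps power2_eq_square)
    finally have "(inner (x - p) y)\<^sup>2 / (norm y)\<^sup>2 \<le> 0" by simp
    then show ?thesis using False by (simp add: divide_le_0_iff)
  qed simp
  have "cinner (x - p) y = 0" if "y \<in> M" for y
    using that M(1) by (intro cinner_eq_zeroI) (simp add: Re_cinner real complex_vector.subspace_scale)
  then have "x - p \<in> orth_complement M"
    unfolding orth_complement_def by (subst (asm) cinner_commute) auto
  with p(1) show ?thesis by blast
qed

lemma subspace_orth_complement: "csubspace (orth_complement M)"
  unfolding orth_complement_def
  by (rule complex_vector.subspaceI) (simp_all add: cinner_add_right cinner_scaleC_right)

definition orth_proj :: "'a::complex_inner set \<Rightarrow> 'a \<Rightarrow> 'a" where
  "orth_proj M x = (SOME p. p \<in> M \<and> x - p \<in> orth_complement M)"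

locale closed_csubspace =
  fixes M :: "'a::{complex_inner, complete_space} set"
  assumes subspace: "csubspace M" and closed: "closed M"
begin

lemma orth_proj_in: "orth_proj M x \<in> M"
  and orth_proj_residual: "x - orth_proj M x \<in> orth_complement M"
  using someI_ex[of "\<lambda>p. p \<in> M \<and> x - p \<in> orth_complement M"]
    orthogonal_decomposition[OF subspace closed, of x]
  by (auto simp: orth_proj_def)

lemma orth_proj_eqI:
  assumes "p \<in> M" "x - p \<in> orth_complement M"
  shows "orth_proj M x = p"
proof -
  let ?q = "orth_proj M x"
  have "p - ?q \<in> M"
    using assms(1) orth_proj_in subspace by (rule complex_vector.subspace_diff[rotated])
  moreover have "(x - ?q) - (x - p) \<in> orth_complement M"
    by (rule complex_vector.subspace_diff[OF subspace_orth_complement orth_proj_residual assms(2)])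
  then have "p - ?q \<in> orth_complement M" by simp
  ultimately have "cinner (p - ?q) (p - ?q) = 0" by (auto simp: orth_complement_def)
  then show ?thesis by simp
qed

lemma orth_proj_add: "orth_proj M (x + y) = orth_proj M x + orth_proj M y"
proof (rule orth_proj_eqI)
  show "orth_proj M x + orth_proj M y \<in> M"
    by (intro complex_vector.subspace_add subspace orth_proj_in)
  have "(x - orth_proj M x) + (y - orth_proj M y) \<in> orth_complement M"
    by (intro complex_vector.subspace_add subspace_orth_complement orth_proj_residual)
  then show "x + y - (orth_proj M x + orth_proj M y) \<in> orth_complement M"
    by (simp add: algebra_simps)
qed

lemma orth_proj_scaleC: "orth_proj M (a *\<^sub>C x) = a *\<^sub>C orth_proj M x"
proof (rule orth_proj_eqI)
  show "a *\<^sub>C orth_proj M x \<in> M"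
    by (intro complex_vector.subspace_scale subspace orth_proj_in)
  have "a *\<^sub>C (x - orth_proj M x) \<in> orth_complement M"
    by (intro complex_vector.subspace_scale subspace_orth_complement orth_proj_residual)
  then show "a *\<^sub>C x - a *\<^sub>C orth_proj M x \<in> orth_complement M"
    by (simp add: complex_vector.scale_right_diff_distrib)
qed

lemma orth_proj_id: "x \<in> M \<Longrightarrow> orth_proj M x = x"
  by (rule orth_proj_eqI) (simp_all add: complex_vector.subspace_0 subspace_orth_complement)

lemma orth_proj_selfadjoint: "cinner (orth_proj M x) y = cinner x (orth_proj M y)"
proof -
  have *: "cinner (orth_proj M u) (z - orth_proj M z) = 0" for u z
    using orth_proj_in[of u] orth_proj_residual[of z] by (auto simp: orth_complement_def)
  have "cinner (orth_proj M x) y = cinner (orth_proj M x) (orth_proj M y)"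
    using *[of x y] cinner_add_right[of "orth_proj M x" "orth_proj M y" "y - orth_proj M y"] by simp
  moreover have "cinner (x - orth_proj M x) (orth_proj M y) = 0"
    by (subst cinner_commute) (simp add: *)
  ultimately show ?thesis by (simp add: cinner_diff_left)
qed

text \<open>A reducing subspace is one whose orthogonal projection commutes with the operator.\<close>

lemma orth_proj_commute:
  assumes T: "\<And>x y. T (x + y) = T x + T y"
    and "T ` M \<subseteq> M" "T ` orth_complement M \<subseteq> orth_complement M"
  shows "orth_proj M (T x) = T (orth_proj M x)"
proof (rule orth_proj_eqI)
  show "T (orth_proj M x) \<in> M" using assms(2) orth_proj_in by blast
  have "T x = T (orth_proj M x) + T (x - orth_proj M x)" by (simp flip: T)
  then show "T x - T (orth_proj M x) \<in> orth_complement M"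
    using assms(3) orth_proj_residual[of x] by auto
qed

end


section \<open>Two-by-two matrices\<close>

definition adj :: "complex^'n^'m \<Rightarrow> complex^'m^'n" where
  "adj A = (\<chi> i j. cnj (A $ j $ i))"

lemma adj_nth [simp]: "adj A $ i $ j = cnj (A $ j $ i)"
  by (simp add: adj_def)

lemma adj_mult: "adj (A ** B) = adj B ** adj A"
  by (simp add: vec_eq_iff matrix_matrix_mult_def mult.commute)

lemma matrix_mult_2: "(A ** B) $ i $ j = A $ i $ 1 * B $ 1 $ j + A $ i $ 2 * B $ 2 $ j"
  for A :: "'a::semiring_1^2^'m"
  by (simp add: matrix_matrix_mult_def sum_2)

lemma matrix_vector_mult_2: "(A *v x) $ i = A $ i $ 1 * x $ 1 + A $ i $ 2 * x $ 2"
  for A :: "'a::semiring_1^2^'m"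
  by (simp add: matrix_vector_mult_def sum_2)

lemma mat_nth: "mat k $ i $ j = (if i = j then k else 0)"
  by (simp add: mat_def)

lemmas matrix_2_simps = vec_eq_iff forall_2 matrix_mult_2 matrix_vector_mult_2 mat_nth

lemma matrix_mult_zero [simp]: "0 ** A = 0" "B ** 0 = 0"
  by (simp_all add: vec_eq_iff matrix_matrix_mult_def)

lemma Cayley_Hamilton_2: "A ** A = mat (trace A) ** A - mat (det A)" for A :: "'a::comm_ring_1^2^2"
  by (simp add: matrix_2_simps trace_def sum_2 det_2 algebra_simps)

text \<open>
  Intertwined matrices with equal determinant and different trace have disjoint spectra, which
  leaves no room for a nonzero intertwiner.  The Cayley--Hamilton identity shows this directly: it
  turns \<open>A\<^sup>2Q = QB\<^sup>2\<close> into \<open>(trace A - trace B) AQ = 0\<close>.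
\<close>

lemma intertwiner_eq_0:
  fixes A B Q :: "'a::field^2^2"
  assumes AQ: "A ** Q = Q ** B" and "trace A \<noteq> trace B" "det A = det B" "det A \<noteq> 0"
  shows "Q = 0"
proof -
  have comm: "Q ** mat k = mat k ** Q" for k :: 'a and Q :: "'a^2^2"
    by (simp add: matrix_2_simps)
  have diff: "(X - Y) ** Z = X ** Z - Y ** Z" "Z ** (X - Y) = Z ** X - Z ** Y"
    for X Y Z :: "'a^2^2"
    by (simp_all add: matrix_2_simps algebra_simps)
  have "(A ** A) ** Q = Q ** (B ** B)"
    by (metis AQ matrix_mul_assoc)
  moreover have "(A ** A) ** Q = mat (trace A) ** (A ** Q) - mat (det A) ** Q"
    by (simp add: Cayley_Hamilton_2 diff matrix_mul_assoc)
  moreover have "Q ** (B ** B) = mat (trace B) ** (A ** Q) - mat (det A) ** Q"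
    by (simp add: Cayley_Hamilton_2 diff assms(3) AQ matrix_mul_assoc comm)
  ultimately have "mat (trace A) ** (A ** Q) = mat (trace B) ** (A ** Q)" by simp
  then have "A ** Q = 0" using assms(2) by (simp add: matrix_2_simps)
  moreover obtain A' where "A' ** A = mat 1"
    using assms(4) invertible_det_nz invertible_def by blast
  ultimately have "mat 1 ** Q = A' ** 0" by (metis matrix_mul_assoc)
  then show ?thesis by simp
qed

text \<open>
  Modulo scalars a two-by-two matrix is a vector in a three-dimensional space, and two matrices
  commute exactly when their vectors are parallel; a nonzero vector cannot be parallel to two
  vectors that are not parallel to each other.
\<close>

lemma commutes_with_noncommuting_pair_imp_scalar:
  fixes A B Q :: "'a::field^2^2"
  assumes QA: "Q ** A = A ** Q" and QB: "Q ** B = B ** Q" and AB: "A ** B \<noteq> B ** A"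
  obtains k where "Q = mat k"
proof -
  have parallel: "X ** Y = Y ** X \<longleftrightarrow>
      X$1$2 * Y$2$1 = X$2$1 * Y$1$2 \<and>
      (X$1$1 - X$2$2) * Y$1$2 = X$1$2 * (Y$1$1 - Y$2$2) \<and>
      X$2$1 * (Y$1$1 - Y$2$2) = (X$1$1 - X$2$2) * Y$2$1" for X Y :: "'a^2^2"
    by (auto simp: matrix_2_simps algebra_simps)
  have "Q$1$2 = 0 \<and> Q$2$1 = 0 \<and> Q$1$1 = Q$2$2"
  proof (rule ccontr)
    assume neq: "\<not> ?thesis"
    define q r s where "q = Q$1$2" and "r = Q$2$1" and "s = Q$1$1 - Q$2$2"
    have nz: "q \<noteq> 0 \<or> r \<noteq> 0 \<or> s \<noteq> 0" using neq by (auto simp: q_def r_def s_def)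
    have cross: "a1 * b2 = a2 * b1 \<and> a3 * b1 = a1 * b3 \<and> a2 * b3 = a3 * b2"
      if "q * a2 = r * a1" "s * a1 = q * a3" "r * a3 = s * a2"
         "q * b2 = r * b1" "s * b1 = q * b3" "r * b3 = s * b2" for a1 a2 a3 b1 b2 b3 :: 'a
    proof -
      \<comment> \<open>Each equation follows after multiplication by any coordinate of the vector of \<open>Q\<close>.\<close>
      have "x * (a1 * b2) = x * (a2 * b1) \<and> x * (a3 * b1) = x * (a1 * b3) \<and> x * (a2 * b3) = x * (a3 * b2)"
        if "x = q \<or> x = r \<or> x = s" for x
        using that \<open>q * a2 = r * a1\<close> \<open>s * a1 = q * a3\<close> \<open>r * a3 = s * a2\<close>
          \<open>q * b2 = r * b1\<close> \<open>s * b1 = q * b3\<close> \<open>r * b3 = s * b2\<close> by (elim disjE) (intro conjI; algebra)+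
      then show ?thesis using nz by (metis mult_left_cancel)
    qed
    have "A ** B = B ** A"
      using QA QB unfolding parallel q_def[symmetric] r_def[symmetric] s_def[symmetric]
      by (intro cross) auto
    with AB show False by blast
  qed
  then have "Q = mat (Q$1$1)" by (simp add: matrix_2_simps)
  then show ?thesis by (rule that)
qed


section \<open>Block shifts\<close>

definition block :: "'a ell2 \<times> 'a ell2 \<Rightarrow> 'a \<Rightarrow> complex^2" where
  "block x n = vector [coord (fst x) n, coord (snd x) n]"

definition block_vec :: "'a \<Rightarrow> complex^2 \<Rightarrow> 'a ell2 \<times> 'a ell2" where
  "block_vec n c = (c $ 1 *\<^sub>C ebasis n, c $ 2 *\<^sub>C ebasis n)"

lemma block_nth [simp]: "block x n $ 1 = coord (fst x) n" "block x n $ 2 = coord (snd x) n"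
  by (simp_all add: block_def)

lemma block_eqI: "(\<And>n. block x n = block y n) \<Longrightarrow> x = y"
  by (simp add: prod_eq_iff vec_eq_iff forall_2 fun_eq_iff flip: coord_inject)

lemma block_add: "block (x + y) n = block x n + block y n"
  by (simp add: vec_eq_iff forall_2 plus_ell2.rep_eq)

lemma block_scaleC: "block (a *\<^sub>C x) n = a *s block x n"
  by (simp add: vec_eq_iff forall_2 scaleC_prod_def scaleC_ell2.rep_eq)

lemma block_block_vec: "block (block_vec m c) n = (if n = m then c else 0)"
  by (simp add: vec_eq_iff forall_2 block_vec_def scaleC_ell2.rep_eq ebasis.rep_eq)

lemma block_vec_add: "block_vec n (x + y) = block_vec n x + block_vec n y"
  by (simp add: block_vec_def scaleC_add_left)

lemma block_vec_scale: "block_vec n (a *s x) = a *\<^sub>C block_vec n x"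
  by (simp add: block_vec_def scaleC_prod_def scaleC_scaleC)

lemma block_vec_eq_iff [simp]: "block_vec n x = block_vec n y \<longleftrightarrow> x = y"
  by (metis block_block_vec)

lemma block_vec_zero [simp]: "block_vec n 0 = 0"
  by (simp add: block_vec_def zero_prod_def)

lemma cinner_ebasis: "cinner x (ebasis n) = coord x n"
proof -
  have "(\<Sum>\<^sub>\<infinity>i. coord x i * cnj (coord (ebasis n) i)) = (\<Sum>\<^sub>\<infinity>i\<in>{n}. coord x i)"
    by (intro infsum_cong_neutral) (auto simp: ebasis.rep_eq)
  then show ?thesis by (simp add: cinner_ell2.rep_eq)
qed

lemma cinner_block_vec:
  "cinner x (block_vec n c) = block x n $ 1 * cnj (c $ 1) + block x n $ 2 * cnj (c $ 2)"
  by (simp add: cinner_prod_def block_vec_def cinner_scaleC_right cinner_ebasis)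

lemma cinner_block_vec_axis: "cinner x (block_vec n (axis s 1)) = block x n $ s"
  using exhaust_2[of s] by (auto simp: cinner_block_vec axis_def)

lemma cinner_block_vec_adj:
  "cinner (block_vec m (A *v x)) (block_vec m y) = cinner (block_vec n x) (block_vec n (adj A *v y))"
  by (simp add: cinner_block_vec block_block_vec matrix_vector_mult_2 algebra_simps)

text \<open>
  For reducing subspaces only the action of the operator on coordinate blocks matters, so the
  irreducibility criterion is proved for every additive operator that sends block \<open>n\<close> to block
  \<open>n + 1\<close> by a matrix \<open>B n\<close>.
\<close>

locale block_shift =
  fixes T :: "int ell2 \<times> int ell2 \<Rightarrow> int ell2 \<times> int ell2" and B :: "int \<Rightarrow> complex^2^2"
  assumes T_add: "T (x + y) = T x + T y"
    and block_T: "block (T x) (n + 1) = B n *v block x n"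
begin

lemma T_block_vec: "T (block_vec n c) = block_vec (n + 1) (B n *v c)"
proof (rule block_eqI)
  fix m
  have "block (T (block_vec n c)) (m - 1 + 1) = B (m - 1) *v (if m - 1 = n then c else 0)"
    unfolding block_T block_block_vec ..
  then show "block (T (block_vec n c)) m = block (block_vec (n + 1) (B n *v c)) m"
    by (auto simp: block_block_vec)
qed

end

locale block_shift_reducing = block_shift +
  fixes M
  assumes reducing: "reducing_subspace T M"
begin

sublocale closed_csubspace M
  using reducing by unfold_locales (auto simp: reducing_subspace_def)

definition proj_block :: "int \<Rightarrow> int \<Rightarrow> complex^2^2" where
  "proj_block i j = matrix (\<lambda>c. block (orth_proj M (block_vec j c)) i)"

lemma proj_block_mult: "proj_block i j *v c = block (orth_proj M (block_vec j c)) i"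
  unfolding proj_block_def
  by (rule matrix_works)
    (simp add: Vector_Spaces.linear_iff vec.vector_space_axioms block_vec_add block_vec_scale
      orth_proj_add orth_proj_scaleC block_add block_scaleC)

lemma proj_block_adj: "adj (proj_block i j) = proj_block j i"
proof -
  have "proj_block i j $ s $ t =
      cinner (orth_proj M (block_vec j (axis t 1))) (block_vec i (axis s 1))" for i j s t
    by (simp add: proj_block_def matrix_def cinner_block_vec_axis)
  then show ?thesis
    unfolding vec_eq_iff adj_nth by (metis cinner_commute orth_proj_selfadjoint)
qed

lemma proj_block_shift: "proj_block (i + 1) (j + 1) ** B j = B i ** proj_block i j"
proof -
  have comm: "orth_proj M (T x) = T (orth_proj M x)" for x
    using reducing by (intro orth_proj_commute T_add) (auto simp: reducing_subspace_def)
  show ?thesis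
    unfolding matrix_eq
    by (simp add: proj_block_mult comm block_T flip: matrix_vector_mul_assoc T_block_vec)
qed

text \<open>
  Since the projection is self-adjoint, taking adjoints turns the relation with \<open>B\<close> into one with
  \<open>adj B\<close>.
\<close>

lemma proj_block_shift_adj: "adj (B i) ** proj_block (i + 1) (j + 1) = proj_block i j ** adj (B j)"
  using arg_cong[OF proj_block_shift[of j i], of adj] by (simp add: adj_mult proj_block_adj)

lemma proj_block_intertwines:
  "(adj (B i) ** B i) ** proj_block i j = proj_block i j ** (adj (B j) ** B j)"
  by (simp add: matrix_mul_assoc flip: proj_block_shift_adj)
    (simp add: proj_block_shift flip: matrix_mul_assoc)

lemma proj_block_intertwines':
  "(B i ** adj (B i)) ** proj_block (i + 1) (j + 1) = proj_block (i + 1) (j + 1) ** (B j ** adj (B j))"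
  by (simp add: matrix_mul_assoc proj_block_shift)
    (simp add: proj_block_shift_adj flip: matrix_mul_assoc)

end

text \<open>
  Distinct traces far to the right kill the off-diagonal blocks of the projection there, and the
  shift relation carries the vanishing back to all blocks.  A noncommuting pair at one place makes
  one diagonal block scalar, and the shift relation spreads this scalar to every diagonal block.
\<close>

theorem (in block_shift) irreducible:
  assumes det: "\<And>n. det (adj (B n) ** B n) = 1"
    and distinct: "\<And>i j. i > N \<Longrightarrow> j > N \<Longrightarrow> i \<noteq> j \<Longrightarrow>
      trace (adj (B i) ** B i) \<noteq> trace (adj (B j) ** B j)"
    and noncomm: "(adj (B n) ** B n) ** (B (n - 1) ** adj (B (n - 1)))
      \<noteq> (B (n - 1) ** adj (B (n - 1))) ** (adj (B n) ** B n)"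
  shows "irreducible_operator T"
  unfolding irreducible_operator_def
proof (intro allI impI)
  fix M assume "reducing_subspace T M"
  then interpret block_shift_reducing T B M by unfold_locales
  have B_inv: "invertible (B n)" for n
    using det[of n] by (auto simp: invertible_det_nz det_mul)
  have B_cancel_left: "X = Y" if "B n ** X = B n ** Y" for n and X Y :: "complex^2^2"
  proof -
    obtain B' where B': "B' ** B n = mat 1" using B_inv invertible_def by blast
    have "B' ** (B n ** X) = B' ** (B n ** Y)" using that by simp
    then show ?thesis by (simp add: matrix_mul_assoc B')
  qed
  have B_cancel_right: "X = Y" if "X ** B n = Y ** B n" for n and X Y :: "complex^2^2"
  proof -
    obtain B' where B': "B n ** B' = mat 1" using B_inv invertible_def by blast
    have "(X ** B n) ** B' = (Y ** B n) ** B'" using that by simp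
    then show ?thesis by (simp add: B' flip: matrix_mul_assoc)
  qed

  have zero_right: "proj_block i j = 0" if "i > N" "j > N" "i \<noteq> j" for i j
    by (rule intertwiner_eq_0[OF proj_block_intertwines]) (use distinct[OF that] det in auto)
  have back_step: "proj_block i j = 0" if "proj_block (i + 1) (j + 1) = 0" for i j
    by (rule B_cancel_left[of i]) (simp add: that flip: proj_block_shift)
  have "proj_block i j = 0" if "proj_block (i + int k) (j + int k) = 0" for i j k
    using that
  proof (induction k)
    case (Suc k)
    then show ?case using back_step[of "i + int k" "j + int k"] by (simp add: ac_simps)
  qed simp
  \<comment> \<open>A shift far enough moves any pair of indices to the right of \<open>N\<close>.\<close>
  moreover have "\<exists>k. i + int k > N \<and> j + int k > N" for i j
    by (intro exI[of _ "nat (\<bar>N\<bar> + \<bar>i\<bar> + \<bar>j\<bar> + 1)"]) auto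
  ultimately have off: "proj_block i j = 0" if "i \<noteq> j" for i j
    using zero_right that by (metis add_right_cancel)

  obtain k where k: "proj_block n n = mat k"
    using commutes_with_noncommuting_pair_imp_scalar[OF proj_block_intertwines[symmetric] _ noncomm]
      proj_block_intertwines'[of "n - 1" "n - 1", symmetric] by auto
  have mat_comm: "mat k ** X = X ** mat k" for X :: "complex^2^2"
    by (simp add: matrix_2_simps)
  have diag: "proj_block m m = mat k" for m
  proof (induction m rule: int_induct[where k = n])
    case base
    show ?case by (rule k)
  next
    case (step1 i)
    show ?case
      by (rule B_cancel_right[of _ i]) (simp add: mat_comm step1 proj_block_shift)
  next
    case (step2 i)
    show ?case
      using proj_block_shift[of "i - 1" "i - 1"]
      by - (rule B_cancel_left[of "i - 1"], simp add: mat_comm step2)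
  qed
  have proj: "orth_proj M (block_vec m c) = k *\<^sub>C block_vec m c" for m c
  proof (rule block_eqI)
    fix i
    have "block (orth_proj M (block_vec m c)) i = proj_block i m *v c"
      by (rule proj_block_mult[symmetric])
    also have "\<dots> = block (k *\<^sub>C block_vec m c) i"
      using off[of i m] diag[of m]
      by (auto simp: block_scaleC block_block_vec matrix_2_simps)
    finally show "block (orth_proj M (block_vec m c)) i = block (k *\<^sub>C block_vec m c) i" .
  qed
  have orth_all: "x = 0" if "\<And>m c. cinner x (block_vec m c) = 0" for x :: "int ell2 \<times> int ell2"
    using that by (intro block_eqI) (simp add: vec_eq_iff flip: cinner_block_vec_axis)
  \<comment> \<open>The scalar is 0 or 1 as for every projection; it suffices to distinguish whether it vanishes.\<close>
  show "M = {0} \<or> M = UNIV"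
  proof (cases "k = 0")
    case True
    have "x = 0" if "x \<in> M" for x
    proof (rule orth_all)
      fix m c
      have "cinner x (block_vec m c) = cinner (orth_proj M x) (block_vec m c)"
        using that by (simp add: orth_proj_id)
      then show "cinner x (block_vec m c) = 0" by (simp add: orth_proj_selfadjoint proj True)
    qed
    then show ?thesis using complex_vector.subspace_0[OF subspace] by blast
  next
    case False
    have "block_vec m c \<in> M" for m c
    proof -
      have "k *\<^sub>C block_vec m c \<in> M" by (metis proj orth_proj_in)
      then have "inverse k *\<^sub>C k *\<^sub>C block_vec m c \<in> M"
        by (rule complex_vector.subspace_scale[OF subspace])
      then show ?thesis using False by simp
    qed
    then have "x - orth_proj M x = 0" for x
      using orth_proj_residual[of x]
      by (intro orth_all, subst cinner_commute) (auto simp: orth_complement_def)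
    then have "x \<in> M" for x
      using orth_proj_in[of x] by (metis right_minus_eq)
    then show ?thesis by blast
  qed
qed


section \<open>Singular values of the diagonal blocks\<close>

lemma H_sp_eq_range: "H_sp n = range (block_vec n)"
proof
  have "csubspace (range (block_vec n))"
  proof (rule complex_vector.subspaceI)
    show "0 \<in> range (block_vec n)" by (rule range_eqI[of _ _ 0]) simp
  qed (auto simp flip: block_vec_add block_vec_scale)
  moreover have "(ebasis n, 0) = block_vec n (axis 1 1)" "(0, ebasis n) = block_vec n (axis 2 1)"
    by (simp_all add: block_vec_def axis_def)
  ultimately show "H_sp n \<subseteq> range (block_vec n)"
    unfolding H_sp_def by (intro complex_vector.span_minimal) auto
  have "block_vec n c = (c $ 1) *\<^sub>C (ebasis n, 0) + (c $ 2) *\<^sub>C (0, ebasis n)" for c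
    by (simp add: block_vec_def scaleC_prod_def)
  then show "range (block_vec n) \<subseteq> H_sp n"
    unfolding H_sp_def
    by (auto intro!: complex_vector.span_add complex_vector.span_scale intro: complex_vector.span_base)
qed

text \<open>
  The definite description in the adjoint is resolved by the adjoint matrix; uniqueness holds
  because the inner product is nondegenerate on each coordinate plane.
\<close>

lemma adjoint_on_block:
  assumes "\<And>c. S (block_vec n c) = block_vec m (A *v c)"
  shows "adjoint_on (H_sp n) S (block_vec m y) = block_vec n (adj A *v y)"
  unfolding adjoint_on_def
proof (rule the_equality)
  show "block_vec n (adj A *v y) \<in> H_sp n \<and>
      (\<forall>u\<in>H_sp n. cinner (S u) (block_vec m y) = cinner u (block_vec n (adj A *v y)))"
    by (auto simp: H_sp_eq_range assms cinner_block_vec_adj[of m A _ y n])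
  fix x
  assume x: "x \<in> H_sp n \<and> (\<forall>u\<in>H_sp n. cinner (S u) (block_vec m y) = cinner u x)"
  then obtain z where z: "x = block_vec n z" by (auto simp: H_sp_eq_range)
  have eq: "cinner (block_vec n c) (block_vec n (adj A *v y)) = cinner (block_vec n c) (block_vec n z)"
    for c
    using x unfolding z by (simp add: H_sp_eq_range assms cinner_block_vec_adj[of m A _ y n])
  have "z = adj A *v y"
    using eq[of "axis 1 1"] eq[of "axis 2 1"]
    by (simp add: cinner_block_vec block_block_vec vec_eq_iff forall_2 axis_def
        del: cinner_block_vec_axis)
  then show "x = block_vec n (adj A *v y)" by (simp add: z)
qed

lemma singular_values_on_block:
  assumes S: "\<And>c. S (block_vec n c) = block_vec n (A *v c)"
  shows "singular_values_on (H_sp n) S =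
    {s. 0 \<le> s \<and> (\<exists>c. c \<noteq> 0 \<and> (adj A ** A) *v c = complex_of_real (s\<^sup>2) *s c)}"
proof -
  have zero: "block_vec n c = 0 \<longleftrightarrow> c = 0" for c
    by (metis block_vec_eq_iff block_vec_zero)
  have "(\<exists>x\<in>H_sp n. P x) \<longleftrightarrow> (\<exists>c. P (block_vec n c))" for P
    by (auto simp: H_sp_eq_range)
  then show ?thesis
    unfolding singular_values_on_def
    by (simp add: S adjoint_on_block[OF S] zero matrix_vector_mul_assoc flip: block_vec_scale)
qed

text \<open>
  For Hermitian matrices a unitary that intertwines \<open>G\<close> and \<open>G'\<close> also intertwines \<open>G\<^sup>*G\<close> and
  \<open>G'\<^sup>*G'\<close>, so it carries eigenvectors to eigenvectors.
\<close>

lemma eigenvalues_unitary_mono: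
  fixes G G' U :: "complex^2^2"
  assumes U: "adj U ** U = mat 1" and GU: "G' ** U = U ** G" and "adj G = G" "adj G' = G'"
    and c: "c \<noteq> 0" "(adj G ** G) *v c = k *s c"
  shows "\<exists>c'. c' \<noteq> 0 \<and> (adj G' ** G') *v c' = k *s c'"
proof (intro exI conjI)
  show "U *v c \<noteq> 0"
  proof
    assume "U *v c = 0"
    then have "(adj U ** U) *v c = 0" by (simp flip: matrix_vector_mul_assoc)
    with U c(1) show False by simp
  qed
  have "(adj G' ** G') ** U = U ** (adj G ** G)"
    by (metis assms(3,4) GU matrix_mul_assoc)
  then have "(adj G' ** G') *v (U *v c) = U *v ((adj G ** G) *v c)"
    by (simp only: matrix_vector_mul_assoc)
  then show "(adj G' ** G') *v (U *v c) = k *s (U *v c)"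
    by (simp only: c(2) vector_scalar_commute)
qed

text \<open>
  The general shape of \<open>T\<^sub>n\<^sup>*T\<^sub>n\<close> for unimodular weights.  A diagonal unitary can rotate the phase of
  \<open>b\<close> arbitrarily, so up to unitary equivalence only \<open>|b|\<close> matters.
\<close>

definition gram_matrix :: "complex \<Rightarrow> complex^2^2" where
  "gram_matrix b = vector [vector [1, b], vector [cnj b, 1 + b * cnj b]]"

lemma adj_gram_matrix: "adj (gram_matrix b) = gram_matrix b"
  by (simp add: gram_matrix_def matrix_2_simps)

lemma trace_gram_matrix: "trace (gram_matrix b) = complex_of_real (2 + (cmod b)\<^sup>2)"
  using complex_norm_square[of b] by (simp add: gram_matrix_def trace_def sum_2)

lemma det_gram_matrix: "det (gram_matrix b) = 1"
  by (simp add: gram_matrix_def det_2)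

lemma gram_matrix_unitary:
  assumes "cmod b = cmod b'"
  obtains U where "adj U ** U = mat 1" "gram_matrix b' ** U = U ** gram_matrix b"
proof -
  define u where "u = (if b' = 0 then 1 else b / b')"
  have eq: "b * cnj b = b' * cnj b'"
    using assms by (simp flip: complex_norm_square)
  have u: "cnj u * u = 1" "b' * u = b" "cnj b' = u * cnj b"
    using assms eq by (auto simp: u_def field_simps)
  let ?U = "vector [vector [1, 0], vector [0, u]] :: complex^2^2"
  have "adj ?U ** ?U = mat 1" "gram_matrix b' ** ?U = ?U ** gram_matrix b"
    using u eq by (simp_all add: gram_matrix_def matrix_2_simps algebra_simps)
  then show ?thesis by (rule that)
qed

text \<open>
  By contraposition, blocks with different singular values have different \<open>|b|\<close>, hence
  different trace.
\<close>

lemma singular_values_gram_matrix_cong: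
  assumes "\<And>c. S (block_vec n c) = block_vec n (gram_matrix b *v c)"
    and "\<And>c. S' (block_vec m c) = block_vec m (gram_matrix b' *v c)"
    and "cmod b = cmod b'"
  shows "singular_values_on (H_sp n) S = singular_values_on (H_sp m) S'"
proof -
  have "\<exists>c'. c' \<noteq> 0 \<and> (adj (gram_matrix b') ** gram_matrix b') *v c' = k *s c'"
    if "cmod b = cmod b'" "c \<noteq> 0" "(adj (gram_matrix b) ** gram_matrix b) *v c = k *s c"
    for b b' c k
    using that gram_matrix_unitary[of b b'] eigenvalues_unitary_mono adj_gram_matrix by metis
  then show ?thesis
    unfolding singular_values_on_block[of S n, OF assms(1)] singular_values_on_block[of S' m, OF assms(2)]
    using assms(3) by (metis (no_types, lifting))
qed


section \<open>The operator \<open>T\<close>\<close>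

definition T_matrix ::
  "(int \<Rightarrow> complex) \<Rightarrow> (int \<Rightarrow> complex) \<Rightarrow> (int \<Rightarrow> complex) \<Rightarrow> int \<Rightarrow> complex^2^2" where
  "T_matrix w v d n = vector [vector [w n, d (n + 1) * v n - d n * w n], vector [0, v n]]"

lemma block_shift_T_op:
  assumes "bounded (range w)" "bounded (range v)" "bounded (range d)"
  shows "block_shift (T_op w v d) (T_matrix w v d)"
proof
  fix x y :: "int ell2 \<times> int ell2" and n :: int
  have T: "block (T_op w v d z) m = T_matrix w v d (m - 1) *v block z (m - 1)" for z m
    by (cases z) (simp add: T_op_def T_matrix_def matrix_2_simps plus_ell2.rep_eq minus_ell2.rep_eq
        coord_bshift coord_diag_op assms algebra_simps)
  then show "block (T_op w v d x) (n + 1) = T_matrix w v d n *v block x n" by simp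
  show "T_op w v d (x + y) = T_op w v d x + T_op w v d y"
    by (rule block_eqI) (simp add: T block_add matrix_vector_right_distrib)
qed

lemma gram_T_matrix:
  assumes "cmod (w n) = 1" "cmod (v n) = 1"
  shows "adj (T_matrix w v d n) ** T_matrix w v d n
    = gram_matrix (cnj (w n) * (d (n + 1) * v n - d n * w n))"
proof -
  have "cnj (w n) * w n = 1" "cnj (v n) * v n = 1"
    using assms complex_norm_square[of "w n"] complex_norm_square[of "v n"]
    by (simp_all add: mult.commute)
  then show ?thesis
    by (simp add: T_matrix_def gram_matrix_def matrix_2_simps)
qed

text \<open>
  Either alternative of the irreducibility hypothesis makes \<open>T\<^sub>n\<^sup>*T\<^sub>n\<close> and
  \<open>T\<^sub>n\<^sub>-\<^sub>1T\<^sub>n\<^sub>-\<^sub>1\<^sup>*\<close> noncommuting.  Both matrices are Hermitian; let \<open>b\<close> and \<open>b0\<close> be their upper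
  right entries.  A diagonal entry of the commutator is the imaginary part of \<open>b cnj b0\<close> (up to a
  factor), which condition (1) asserts to be nonzero: its expression differs from \<open>b cnj b0\<close> by
  the real number \<open>|d\<^sub>n|\<^sup>2\<close>.  The vanishing of the off-diagonal entry says that \<open>b\<close> and \<open>b0\<close> are
  proportional to the differences of the diagonal entries; condition (2) is the negation of the
  conjugate of this equation.
\<close>

lemma T_matrix_commuting_imp:
  fixes w v d :: "int \<Rightarrow> complex"
  assumes w: "\<And>n. cmod (w n) = 1" and v: "\<And>n. cmod (v n) = 1"
    and comm: "(adj (T_matrix w v d n) ** T_matrix w v d n)
        ** (T_matrix w v d (n - 1) ** adj (T_matrix w v d (n - 1)))
      = (T_matrix w v d (n - 1) ** adj (T_matrix w v d (n - 1)))
        ** (adj (T_matrix w v d n) ** T_matrix w v d n)"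
  shows "d (n + 1) * c_seq w v d n + d n * c_seq w v d (n - 1)
      - d (n + 1) * cnj (w n) * v n * c_seq w v d (n - 1) \<in> \<real>"
    and "(cnj (d (n + 1)) * w n * cnj (v n) - cnj (d n))
        * complex_of_real ((cmod (d n * v (n - 1) - d (n - 1) * w (n - 1)))\<^sup>2)
      = (cnj (d (n - 1)) * cnj (w (n - 1)) * v (n - 1) - cnj (d n))
        * complex_of_real ((cmod (d (n + 1) * v n - d n * w n))\<^sup>2)"
proof -
  have unit: "cnj (w k) * w k = 1" "cnj (v k) * v k = 1" for k
    using w v complex_norm_square[of "w k"] complex_norm_square[of "v k"]
    by (simp_all add: mult.commute)
  define a a0 where "a = d (n + 1) * v n - d n * w n"
    and "a0 = d n * v (n - 1) - d (n - 1) * w (n - 1)"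
  define b b0 where "b = cnj (w n) * a" and "b0 = a0 * cnj (v (n - 1))"
  have A: "adj (T_matrix w v d n) ** T_matrix w v d n = gram_matrix b"
    by (simp add: gram_T_matrix w v b_def a_def)
  have B: "T_matrix w v d (n - 1) ** adj (T_matrix w v d (n - 1))
      = vector [vector [1 + a0 * cnj a0, b0], vector [cnj b0, 1]]"
    using unit[of "n - 1"]
    by (simp add: T_matrix_def a0_def b0_def matrix_2_simps) (simp add: mult.commute)
  have bb: "b * cnj b = a * cnj a"
    using unit[of n] by (simp add: b_def)
  have real: "b * cnj b0 = b0 * cnj b"
    using arg_cong[OF comm, of "\<lambda>X. X $ 1 $ 1"] unfolding A B
    by (simp add: gram_matrix_def matrix_mult_2)
  have "b0 + b = (1 + a0 * cnj a0) * b + b0 * (1 + b * cnj b)"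
    using arg_cong[OF comm, of "\<lambda>X. X $ 1 $ 2"] unfolding A B
    by (simp add: gram_matrix_def matrix_mult_2)
  then have ratio: "b * (a0 * cnj a0) = - b0 * (a * cnj a)"
    unfolding bb by algebra

  have b_eq: "b = d (n + 1) * cnj (w n) * v n - d n"
    using unit[of n] unfolding b_def a_def by algebra
  have b0_eq: "b0 = d n - d (n - 1) * w (n - 1) * cnj (v (n - 1))"
    using unit[of "n - 1"] unfolding b0_def a0_def by algebra
  have "b * cnj b0 \<in> \<real>"
    using real by (simp add: complex_is_Real_iff complex_eq_iff)
  moreover have "d n * cnj (d n) \<in> \<real>" by (simp add: complex_is_Real_iff)
  moreover have "d (n + 1) * c_seq w v d n + d n * c_seq w v d (n - 1)
      - d (n + 1) * cnj (w n) * v n * c_seq w v d (n - 1) = b * cnj b0 + d n * cnj (d n)"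
    by (simp add: b_eq b0_eq c_seq_def algebra_simps)
  ultimately show "d (n + 1) * c_seq w v d n + d n * c_seq w v d (n - 1)
      - d (n + 1) * cnj (w n) * v n * c_seq w v d (n - 1) \<in> \<real>"
    by (simp add: Reals_add)

  have "cnj b * (a0 * cnj a0) = - cnj b0 * (a * cnj a)"
    using arg_cong[OF ratio, of cnj] by (simp add: mult.commute)
  then show "(cnj (d (n + 1)) * w n * cnj (v n) - cnj (d n))
        * complex_of_real ((cmod (d n * v (n - 1) - d (n - 1) * w (n - 1)))\<^sup>2)
      = (cnj (d (n - 1)) * cnj (w (n - 1)) * v (n - 1) - cnj (d n))
        * complex_of_real ((cmod (d (n + 1) * v n - d n * w n))\<^sup>2)"
    unfolding complex_norm_square a_def[symmetric] a0_def[symmetric]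
    by (simp add: b_eq b0_eq)
qed

theorem theorem3p7:
  fixes w v d :: "int \<Rightarrow> complex" and g :: "int \<Rightarrow> int" and N :: int
  assumes "\<And>n. w n \<noteq> 0" and "\<And>n. v n \<noteq> 0"
    and "bounded (range d)"
    and "diag_op d \<circ> bshift v \<noteq> bshift w \<circ> diag_op d"
    and "\<And>n. cmod (w n) = 1" and "\<And>n. cmod (v n) = 1"
    and "bij g"
    and "inj_on (\<lambda>n. singular_values_on (H_sp n) (A_op w v d n)) {N<..}"
    and "\<And>n. (cmod (d (n + 1) * v n - d n * w n))\<^sup>2
             = (cmod (d (g n + 1) * v (g n) - d (g n) * w (g n)))\<^sup>2"
    and "(\<forall>n. d (n + 1) * c_seq w v d n + d n * c_seq w v d (n - 1)
               - d (n + 1) * cnj (w n) * v n * c_seq w v d (n - 1) \<notin> \<real>) \<or>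
         (\<forall>n. (cnj (d (n + 1)) * w n * cnj (v n) - cnj (d n))
                 * complex_of_real ((cmod (d n * v (n - 1) - d (n - 1) * w (n - 1)))\<^sup>2)
               \<noteq> (cnj (d (n - 1)) * cnj (w (n - 1)) * v (n - 1) - cnj (d n))
                 * complex_of_real ((cmod (d (n + 1) * v n - d n * w n))\<^sup>2))"
  shows "irreducible_operator (T_op w v d)"
proof -
  define b where "b n = cnj (w n) * (d (n + 1) * v n - d n * w n)" for n
  have gram: "adj (T_matrix w v d n) ** T_matrix w v d n = gram_matrix (b n)" for n
    by (simp add: gram_T_matrix assms(5,6) b_def)
  have "bounded (range w)" "bounded (range v)"
    using assms(5,6) by (auto simp: bounded_iff)
  then interpret block_shift "T_op w v d" "T_matrix w v d"
    using assms(3) by (intro block_shift_T_op)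
  have A_op: "A_op w v d n (block_vec n c) = block_vec n (gram_matrix (b n) *v c)" for n c
    by (simp add: A_op_def T_block_vec adjoint_on_block[OF T_block_vec] matrix_vector_mul_assoc gram)
  show ?thesis
  proof (rule irreducible[where N = N and n = 0])
    show "det (adj (T_matrix w v d n) ** T_matrix w v d n) = 1" for n
      by (simp add: gram det_gram_matrix)
    fix i j assume ij: "i > N" "j > N" "i \<noteq> j"
    have "cmod (b i) \<noteq> cmod (b j)"
      using singular_values_gram_matrix_cong[OF A_op A_op] inj_onD[OF assms(8)] ij
      by (metis greaterThan_iff)
    then show "trace (adj (T_matrix w v d i) ** T_matrix w v d i)
        \<noteq> trace (adj (T_matrix w v d j) ** T_matrix w v d j)"
      by (simp add: gram trace_gram_matrix del: of_real_add of_real_power)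
  next
    show "(adj (T_matrix w v d 0) ** T_matrix w v d 0)
        ** (T_matrix w v d (0 - 1) ** adj (T_matrix w v d (0 - 1)))
      \<noteq> (T_matrix w v d (0 - 1) ** adj (T_matrix w v d (0 - 1)))
        ** (adj (T_matrix w v d 0) ** T_matrix w v d 0)"
      using T_matrix_commuting_imp[where w = w and v = v and d = d and n = 0, OF assms(5,6)] assms(10)
      by blast
  qed
qed

end
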